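(* Let $d\ge 2$ and consider the orthant model on $\mathbb{Z}^d$ with parameter $p\in[0,1]$. Let $0\leq \eta<1$ and suppose $p>\tilde{p}_c(\eta)$. Then there exists a constant $c_p>0$ such that for all $n\in \mathbb{N}$, \[ \mathbb{P}_p\big(0\longrightarrow (-n\mathbf{1}+\mathcal{K}_{\eta})^c\big)\leq \exp(-c_pn). \]
   Context: Let $e_1,\dots,e_d$ be the standard unit basis vectors of $\mathbb{R}^d$, $\mathcal{E}_+=\{e_1,\dots,e_d\}$, $\mathcal{E}_-=\{-e_1,\dots,-e_d\}$, and $\mathbf{1}=e_1+\dots+e_d$. Orthant model with parameter $p$: a random directed graph on $\mathbb{Z}^d$. Independently for each vertex $v\in\mathbb{Z}^d$, with probability $p$ there are directed edges from $v$ to $v+e$ for all $e\in\mathcal{E}_+$ (and no other edges starting at $v$); otherwise, with probability $1-p$, there are directed edges from $v$ to $v+e$ for all $e\in\mathcal{E}_-$ (and no other edges starting at $v$). Its law is denoted $\mathbb{P}_p$. For $v,w\in\mathbb{Z}^d$, $v\longrightarrow w$ means that there is a directed path from $v$ to $w$ (with $v\longrightarrow v$ always). For a set $A$ of points, $v\longrightarrow A$ means that $v\longrightarrow w$ for some vertex $w\in A\cap\mathbb{Z}^d$. The forward cluster of $v$ is $\mathcal{C}_v=\{w\in\mathbb{Z}^d: v\longrightarrow w\}$. For $0\le\eta\le1$, $\mathcal{K}_\eta=\{x\in\mathbb{R}^d: x\cdot\mathbf{1}\ge\eta\|x\|_1\}$, and $(\cdot)^c$ denotes complement. The critical value is \[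 \tilde{p}_c(\eta)=\inf\big\{p: \mathbb{P}_p(\mathcal{C}_0\subset -n\mathbf{1}+\mathcal{K}_\eta \text{ for some }n\in \mathbb{N})=1\big\}. \] *)

theory Defs
  imports "HOL-Probability.Probability"
begin

definition unit_pos :: "(int ^ 'd::finite) set" where
  "unit_pos = range (\<lambda>i. axis i 1)"

definition unit_neg :: "(int ^ 'd::finite) set" where
  "unit_neg = uminus ` unit_pos"

text \<open>
  A configuration \<open>\<omega>\<close> assigns to each vertex of the lattice \<open>int ^ 'd\<close> its local environment:
  \<open>\<omega> v = True\<close> means that the edges starting at \<open>v\<close> are those in the positive directions.
\<close>

definition orthant_edge :: "(int ^ 'd::finite \<Rightarrow> bool) \<Rightarrow> int ^ 'd \<Rightarrow> int ^ 'd \<Rightarrow> bool" where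
  "orthant_edge \<omega> v w \<longleftrightarrow> (\<exists>e \<in> (if \<omega> v then unit_pos else unit_neg). w = v + e)"

text \<open>The law is meaningful for \<open>p\<close> in \<open>[0,1]\<close>; outside that range \<open>bernoulli_pmf\<close> truncates \<open>p\<close>.\<close>

definition orthant_law :: "real \<Rightarrow> (int ^ 'd::finite \<Rightarrow> bool) measure" where
  "orthant_law p = (\<Pi>\<^sub>M v\<in>UNIV. measure_pmf (bernoulli_pmf p))"

definition connects :: "(int ^ 'd::finite \<Rightarrow> bool) \<Rightarrow> int ^ 'd \<Rightarrow> int ^ 'd \<Rightarrow> bool" where
  "connects \<omega> = (orthant_edge \<omega>)\<^sup>*\<^sup>*"

definition to_real_vec :: "int ^ 'd::finite \<Rightarrow> real ^ 'd" where
  "to_real_vec v = (\<chi> i. of_int (v $ i))"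

definition connects_set :: "(int ^ 'd::finite \<Rightarrow> bool) \<Rightarrow> int ^ 'd \<Rightarrow> (real ^ 'd) set \<Rightarrow> bool" where
  "connects_set \<omega> v A \<longleftrightarrow> (\<exists>w. to_real_vec w \<in> A \<and> connects \<omega> v w)"

definition forward_cluster :: "(int ^ 'd::finite \<Rightarrow> bool) \<Rightarrow> int ^ 'd \<Rightarrow> (int ^ 'd) set" where
  "forward_cluster \<omega> v = {w. connects \<omega> v w}"

definition l1_norm :: "real ^ 'd::finite \<Rightarrow> real" where
  "l1_norm x = (\<Sum>i\<in>UNIV. \<bar>x $ i\<bar>)"

text \<open>On \<open>real ^ 'd\<close> the constant \<open>1\<close> is the vector all of whose coordinates are \<open>1\<close>.\<close>

definition cone :: "real \<Rightarrow> (real ^ 'd::finite) set" where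
  "cone \<eta> = {x. x \<bullet> 1 \<ge> \<eta> * l1_norm x}"

definition shifted_cone :: "nat \<Rightarrow> real \<Rightarrow> (real ^ 'd::finite) set" where
  "shifted_cone n \<eta> = (+) (- (real n *\<^sub>R 1)) ` cone \<eta>"

text \<open>
  The infimum ranges over parameters in \<open>[0,1]\<close>. The type argument carries the dimension.
\<close>

definition crit_value :: "'d::finite itself \<Rightarrow> real \<Rightarrow> real" where
  "crit_value _ \<eta> =
     Inf {p \<in> {0..1}.
       \<P>(\<omega> in (orthant_law p :: (int ^ 'd \<Rightarrow> bool) measure).
          \<exists>n. to_real_vec ` forward_cluster \<omega> 0 \<subseteq> shifted_cone n \<eta>) = 1}"

end

theory Submission
  imports Defs
begin

text \<open>
  Call a site open if its edges point in the negative directions; sites are open with probability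
  \<open>r = 1 - p\<close>. Let every site keep its positive edges and let the open sites have the negative ones
  in addition. In this half-orthant model clusters increase with the set of open sites. Since the
  complement of a shifted cone is closed under subtracting unit vectors, it is reached in the
  half-orthant model exactly when it is reached in the orthant model: a path of the former can be
  followed from below in the latter (\<open>half_reach_imp_connects_below\<close>). So the probability
  \<open>\<theta>\<^sub>n(p)\<close> of leaving the shifted cone \<open>n\<close> can be studied in a monotone model. Let the level \<open>h y\<close> of
  a site be the least \<open>n\<close> whose shifted cone contains it. The cone is convex, hence \<open>h\<close> is
  subadditive.

  Because \<open>p\<close> exceeds the critical value, there is \<open>q < p\<close> with \<open>\<theta>\<^sub>n(q) \<rightarrow> 0\<close>. Exponential decay at
  \<open>p\<close> then follows from a comparison of laws. Write \<open>T\<close> for the supremum of \<open>h\<close> on the cluster of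
  the origin and tilt the law with open density \<open>r' = 1 - q\<close> by the decreasing weight
  \<open>exp (- \<kappa> T)\<close>. Under the tilted law \<open>T \<ge> n\<close> has probability at most a constant times
  \<open>exp (- \<kappa> n)\<close>, so it suffices that the tilted law produces at least as large a cluster as the
  law with the smaller density \<open>r\<close>. Explore the cluster site by site. When the site \<open>v\<close> is examined,
  the tilted probability that it is open is \<open>r'\<close> times the ratio of the mean weight given that \<open>v\<close> is
  open to the mean weight. Opening \<open>v\<close> adds only vertices reached from the \<open>d\<close> neighbours of \<open>v\<close>
  through sites that are still unexamined. By subadditivity and translation invariance, with
  probability at least \<open>1 - d \<theta>\<^sub>N(q)\<close> these have level at most \<open>h v + 1 + N\<close>. This event is
  decreasing and so is the weight; by the Harris inequality, opening \<open>v\<close> lowers the mean weight at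
  most by the factor \<open>exp (- \<kappa> (N + 1)) (1 - d \<theta>\<^sub>N(q))\<close>. Choosing first \<open>N\<close> large and then \<open>\<kappa>\<close> small brings that factor
  above \<open>r / r'\<close>. The comparison is \<open>tilted_exploration\<close>; it is carried out inside finite sets of sites,
  with bounds uniform in the set, and gives \<open>escape_prob_exp_decay\<close>.

  This bounds \<open>\<theta>\<^sub>n(p)\<close> by \<open>C exp (- \<kappa> n)\<close>. To absorb \<open>C\<close> for small \<open>n\<close> one needs \<open>\<theta>\<^sub>0(p) < 1\<close>: close all
  sites of a large simplex at the origin and ask that the clusters of the sites on its outer face
  descend by at most \<open>N\<close> levels, which by the Harris inequality has positive probability
  (\<open>escape_prob_0_less_1\<close>).
\<close>

section \<open>Finite Bernoulli expectations and the Harris inequality\<close>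

text \<open>
  The expectation of \<open>f\<close> at the random subset of \<open>B\<close> that contains each element independently with
  probability \<open>r\<close>. As a finite sum it can be conditioned on one element by \<open>bexp_insert\<close>, which is
  what the inductions below need.
\<close>

definition bexp :: "real \<Rightarrow> 'a set \<Rightarrow> ('a set \<Rightarrow> real) \<Rightarrow> real" where
  "bexp r B f = (\<Sum>S\<in>Pow B. (\<Prod>v\<in>B. if v \<in> S then r else 1 - r) * f S)"

lemma bexp_empty [simp]: "bexp r {} f = f {}"
  by (simp add: bexp_def)

lemma bexp_insert:
  assumes "finite B" "v \<notin> B"
  shows "bexp r (insert v B) f = r * bexp r B (\<lambda>S. f (insert v S)) + (1 - r) * bexp r B f"
proof -
  have inj: "inj_on (insert v) (Pow B)"
    using assms by (auto simp: inj_on_def)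
  have disj: "Pow B \<inter> insert v ` Pow B = {}"
    using assms by auto
  have closed: "(\<Prod>u\<in>insert v B. if u \<in> S then r else 1 - r)
      = (1 - r) * (\<Prod>u\<in>B. if u \<in> S then r else 1 - r)" if "S \<in> Pow B" for S
    using assms that by auto
  have opened: "(\<Prod>u\<in>insert v B. if u \<in> insert v S then r else 1 - r)
      = r * (\<Prod>u\<in>B. if u \<in> S then r else 1 - r)" for S
  proof -
    have "(\<Prod>u\<in>B. if u \<in> insert v S then r else 1 - r) = (\<Prod>u\<in>B. if u \<in> S then r else 1 - r)"
      using assms by (intro prod.cong) auto
    then show ?thesis using assms by simp
  qed
  have "bexp r (insert v B) f
      = (\<Sum>S\<in>Pow B. (\<Prod>u\<in>insert v B. if u \<in> S then r else 1 - r) * f S)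
        + (\<Sum>S\<in>Pow B. (\<Prod>u\<in>insert v B. if u \<in> insert v S then r else 1 - r) * f (insert v S))"
    unfolding bexp_def Pow_insert
    using assms by (subst sum.union_disjoint) (auto simp: disj sum.reindex[OF inj])
  also have "\<dots> = (1 - r) * bexp r B f + r * bexp r B (\<lambda>S. f (insert v S))"
    unfolding bexp_def sum_distrib_left opened
    by (intro arg_cong2[of _ _ _ _ "(+)"] sum.cong refl) (simp_all only: closed mult.assoc)
  finally show ?thesis by simp
qed

lemma bexp_cong:
  assumes "\<And>S. S \<subseteq> B \<Longrightarrow> f S = g S"
  shows "bexp r B f = bexp r B g"
  unfolding bexp_def using assms by (intro sum.cong) auto

lemma bexp_mono:
  assumes "0 \<le> r" "r \<le> 1" "\<And>S. S \<subseteq> B \<Longrightarrow> f S \<le> g S"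
  shows "bexp r B f \<le> bexp r B g"
  unfolding bexp_def using assms by (intro sum_mono mult_left_mono prod_nonneg) auto

lemma bexp_const [simp]:
  assumes "finite B"
  shows "bexp r B (\<lambda>_. a) = a"
  using assms by (induction B rule: finite_induct) (auto simp: bexp_insert algebra_simps)

lemma bexp_cmult: "bexp r B (\<lambda>S. a * f S) = a * bexp r B f"
  by (simp add: bexp_def sum_distrib_left mult.left_commute)

lemma bexp_diff: "bexp r B (\<lambda>S. f S - g S) = bexp r B f - bexp r B g"
  by (simp add: bexp_def sum_subtractf right_diff_distrib)

lemma bexp_sum: "bexp r B (\<lambda>S. \<Sum>i\<in>I. f i S) = (\<Sum>i\<in>I. bexp r B (f i))"
  unfolding bexp_def sum_distrib_left by (rule sum.swap)

lemma bexp_nonneg: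
  assumes "0 \<le> r" "r \<le> 1" "\<And>S. S \<subseteq> B \<Longrightarrow> 0 \<le> f S"
  shows "0 \<le> bexp r B f"
  unfolding bexp_def using assms by (intro sum_nonneg mult_nonneg_nonneg prod_nonneg) auto

lemma bexp_not:
  assumes "finite B"
  shows "bexp r B (\<lambda>S. of_bool (\<not> P S)) = 1 - bexp r B (\<lambda>S. of_bool (P S))"
proof -
  have "bexp r B (\<lambda>S. of_bool (\<not> P S)) = bexp r B (\<lambda>S. 1 - of_bool (P S))"
    by (intro bexp_cong) auto
  then show ?thesis using assms by (simp add: bexp_diff)
qed

lemma bexp_closed_ge:
  assumes "finite B" "0 \<le> r" "r \<le> 1"
  shows "1 - r \<le> bexp r B (\<lambda>S. of_bool (v \<notin> S))"
proof (cases "v \<in> B")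
  case True
  then obtain B' where B: "B = insert v B'" "v \<notin> B'"
    by (meson mk_disjoint_insert)
  have "bexp r B' (\<lambda>S. of_bool (v \<notin> S)) = bexp r B' (\<lambda>_. 1)"
    using B by (intro bexp_cong) auto
  then show ?thesis
    using assms unfolding B(1) by (simp add: bexp_insert B(2))
next
  case False
  then have "bexp r B (\<lambda>S. of_bool (v \<notin> S)) = bexp r B (\<lambda>_. 1)"
    by (intro bexp_cong) auto
  then show ?thesis using assms by simp
qed

lemma bexp_image:
  assumes "inj g"
  shows "bexp r (g ` B) f = bexp r B (\<lambda>S. f (g ` S))"
proof -
  have inj: "inj_on ((`) g) (Pow B)"
    using assms by (auto simp: inj_on_def inj_image_eq_iff)
  have "Pow (g ` B) = (`) g ` Pow B"
    by (simp add: image_Pow_surj)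
  moreover have "(\<Prod>v\<in>g ` B. if v \<in> g ` S then r else 1 - r)
      = (\<Prod>v\<in>B. if v \<in> S then r else 1 - r)" for S
    using assms
    by (subst prod.reindex) (auto simp: inj_on_def inj_def inj_image_mem_iff intro!: prod.cong)
  ultimately show ?thesis
    by (simp add: bexp_def sum.reindex[OF inj] o_def)
qed

text \<open>
  Condition on one element at a time. The two conditional means of a decreasing function are
  ordered, so Chebyshev's inequality for two-point distributions gives the induction step.
\<close>

lemma bexp_mult_ge_Harris:
  fixes f g :: "'a set \<Rightarrow> real"
  assumes "finite B" "0 \<le> r" "r \<le> 1" "antimono f" "antimono g"
  shows "bexp r B f * bexp r B g \<le> bexp r B (\<lambda>S. f S * g S)"
  using assms(1,4,5)
proof (induction B arbitrary: f g rule: finite_induct)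
  case empty
  then show ?case by simp
next
  case (insert v B)
  have shift: "antimono (\<lambda>S. k (insert v S))" if "antimono k" for k :: "'a set \<Rightarrow> real"
    using that by (intro antimonoI antimonoD[OF that]) auto
  have less: "bexp r B (\<lambda>S. k (insert v S)) \<le> bexp r B k" if "antimono k" for k :: "'a set \<Rightarrow> real"
    using assms by (intro bexp_mono antimonoD[OF that]) auto
  define f1 f0 g1 g0 where
    "f1 = bexp r B (\<lambda>S. f (insert v S))" and "f0 = bexp r B f" and
    "g1 = bexp r B (\<lambda>S. g (insert v S))" and "g0 = bexp r B g"
  have le: "f1 \<le> f0" "g1 \<le> g0"
    using less insert.prems by (auto simp: f1_def f0_def g1_def g0_def)
  have "0 \<le> r * (1 - r) * ((f0 - f1) * (g0 - g1))"
    using le assms by simp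
  then have "(r * f1 + (1 - r) * f0) * (r * g1 + (1 - r) * g0)
      \<le> r * (f1 * g1) + (1 - r) * (f0 * g0)"
    by (simp add: algebra_simps)
  also have "\<dots> \<le> r * bexp r B (\<lambda>S. f (insert v S) * g (insert v S))
      + (1 - r) * bexp r B (\<lambda>S. f S * g S)"
    using insert.IH[OF shift shift] insert.IH insert.prems assms
    by (intro add_mono mult_left_mono) (auto simp: f1_def f0_def g1_def g0_def)
  finally show ?case
    using insert.hyps by (simp add: bexp_insert f1_def f0_def g1_def g0_def)
qed

lemma bexp_conj_ge_Harris:
  fixes P Q :: "'a set \<Rightarrow> bool"
  assumes "finite B" "0 \<le> r" "r \<le> 1"
    and P: "\<And>S T. P T \<Longrightarrow> S \<subseteq> T \<Longrightarrow> P S" and Q: "\<And>S T. Q T \<Longrightarrow> S \<subseteq> T \<Longrightarrow> Q S"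
  shows "bexp r B (\<lambda>S. of_bool (P S)) * bexp r B (\<lambda>S. of_bool (Q S))
    \<le> bexp r B (\<lambda>S. of_bool (P S \<and> Q S))"
proof -
  have "antimono (\<lambda>S. of_bool (P S) :: real)"
    by (rule antimonoI) (simp add: of_bool_def, blast dest: P)
  moreover have "antimono (\<lambda>S. of_bool (Q S) :: real)"
    by (rule antimonoI) (simp add: of_bool_def, blast dest: Q)
  ultimately have "bexp r B (\<lambda>S. of_bool (P S)) * bexp r B (\<lambda>S. of_bool (Q S))
    \<le> bexp r B (\<lambda>S. of_bool (P S) * of_bool (Q S))"
    by (rule bexp_mult_ge_Harris[OF assms(1-3)])
  then show ?thesis by (simp only: of_bool_conj)
qed

lemma bexp_Ball_ge_Harris:
  fixes P :: "'i \<Rightarrow> 'a set \<Rightarrow> bool"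
  assumes "finite B" "0 \<le> r" "r \<le> 1" "finite I" "0 \<le> a"
    and P: "\<And>i S T. P i T \<Longrightarrow> S \<subseteq> T \<Longrightarrow> P i S"
    and a: "\<And>i. a \<le> bexp r B (\<lambda>S. of_bool (P i S))"
  shows "a ^ card I \<le> bexp r B (\<lambda>S. of_bool (\<forall>i\<in>I. P i S))"
  using \<open>finite I\<close>
proof (induction I rule: finite_induct)
  case empty
  then show ?case using assms by simp
next
  case (insert j I)
  have "a ^ card (insert j I) = a * a ^ card I"
    using insert.hyps by simp
  also have "\<dots> \<le> bexp r B (\<lambda>S. of_bool (P j S)) * bexp r B (\<lambda>S. of_bool (\<forall>i\<in>I. P i S))"
    by (rule mult_mono[OF a insert.IH bexp_nonneg]) (simp_all add: assms)
  also have "\<dots> \<le> bexp r B (\<lambda>S. of_bool (P j S \<and> (\<forall>i\<in>I. P i S)))"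
    by (rule bexp_conj_ge_Harris[OF assms(1-3)]) (blast dest: P)+
  finally show ?case by (simp only: Set.ball_simps)
qed

section \<open>Exploring a cluster under an exponentially tilted law\<close>

text \<open>
  Every vertex keeps its base edges, and the vertices of the set \<open>S\<close> have the bonus edges as well.
  Reachability is then monotone in \<open>S\<close>.
\<close>

locale bonus_digraph =
  fixes base bonus :: "'a \<Rightarrow> 'a \<Rightarrow> bool"
begin

definition reach :: "'a set \<Rightarrow> 'a \<Rightarrow> 'a \<Rightarrow> bool" where
  "reach S = (\<lambda>v w. base v w \<or> v \<in> S \<and> bonus v w)\<^sup>*\<^sup>*"

lemma reach_refl [simp]: "reach S x x"
  by (simp add: reach_def)

lemma reach_base: "reach S x y \<Longrightarrow> base y z \<Longrightarrow> reach S x z"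
  unfolding reach_def by (rule rtranclp.rtrancl_into_rtrancl) auto

lemma reach_bonus: "reach S x y \<Longrightarrow> y \<in> S \<Longrightarrow> bonus y z \<Longrightarrow> reach S x z"
  unfolding reach_def by (rule rtranclp.rtrancl_into_rtrancl) auto

lemma reach_induct [consumes 1, case_names refl base bonus]:
  assumes "reach S x y" "P x"
    and "\<And>y z. reach S x y \<Longrightarrow> P y \<Longrightarrow> base y z \<Longrightarrow> P z"
    and "\<And>y z. reach S x y \<Longrightarrow> P y \<Longrightarrow> y \<in> S \<Longrightarrow> bonus y z \<Longrightarrow> P z"
  shows "P y"
  using assms(1) unfolding reach_def
proof (induction rule: rtranclp_induct)
  case (step y z)
  then show ?case using assms(3,4) unfolding reach_def by blast
qed (fact assms)

lemma reach_mono: "reach S x y \<Longrightarrow> S \<subseteq> T \<Longrightarrow> reach T x y"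
  by (induction rule: reach_induct) (auto intro: reach_base reach_bonus)

lemma reach_finite:
  assumes "reach S x y"
  obtains F where "finite F" "F \<subseteq> S" "reach F x y"
proof -
  have "\<exists>F. finite F \<and> F \<subseteq> S \<and> reach F x y"
    using assms
  proof (induction rule: reach_induct)
    case refl
    show ?case by (rule exI[of _ "{}"]) simp
  next
    case (base y z)
    then show ?case by (auto intro: reach_base)
  next
    case (bonus y z)
    then obtain F where F: "finite F" "F \<subseteq> S" "reach F x y" by auto
    then have "reach (insert y F) x z"
      using bonus by (auto intro: reach_bonus reach_mono)
    then show ?case using F bonus by (intro exI[of _ "insert y F"]) auto
  qed
  then show ?thesis using that by blast
qed

text \<open>
  What opening \<open>v\<close> adds to the cluster of \<open>x\<close>. A path to a new vertex cannot return to the cluster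
  after its last visit to \<open>v\<close>. The examined open sites \<open>s\<close> all lie in the cluster, so the rest of
  the path uses only sites of \<open>S\<close>, whose states are independent of the past of the exploration.
\<close>

lemma reach_insert_fresh_tail:
  assumes "reach (insert v (s \<union> S)) x y"
    and "\<And>u. u \<in> s \<Longrightarrow> reach s x u"
  shows "reach (s \<union> S) x y \<or> (\<exists>w. bonus v w \<and> reach S w y)"
  using assms(1)
proof (induction rule: reach_induct)
  case refl
  then show ?case by simp
next
  case (base y z)
  then show ?case by (meson reach_base)
next
  case (bonus y z)
  have "reach (s \<union> S) x y" if "y \<in> s"
    using assms(2)[OF that] by (rule reach_mono) auto
  then show ?case
    using bonus by (metis Un_iff insert_iff reach_bonus reach_refl)
qed

text \<open>
  For \<open>\<phi> y = exp (- \<kappa> h y)\<close> this is \<open>exp (- \<kappa> T)\<close> with \<open>T\<close> the supremum of \<open>h\<close> on the cluster; the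
  infimum is \<open>0\<close> when \<open>T\<close> is infinite.
\<close>

definition weight :: "('a \<Rightarrow> real) \<Rightarrow> 'a \<Rightarrow> 'a set \<Rightarrow> real" where
  "weight \<phi> x S = (INF y\<in>{y. reach S x y}. \<phi> y)"

context
  fixes \<phi> :: "'a \<Rightarrow> real"
  assumes pos: "\<And>y. 0 \<le> \<phi> y"
begin

lemma weight_le: "reach S x y \<Longrightarrow> weight \<phi> x S \<le> \<phi> y"
  unfolding weight_def using pos by (intro cINF_lower bdd_belowI2[of _ 0]) auto

lemma le_weight: "(\<And>y. reach S x y \<Longrightarrow> a \<le> \<phi> y) \<Longrightarrow> a \<le> weight \<phi> x S"
  unfolding weight_def by (rule cINF_greatest) (auto intro: exI[of _ x])

lemma weight_nonneg: "0 \<le> weight \<phi> x S"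
  using pos by (rule le_weight)

lemma antimono_weight: "antimono (weight \<phi> x)"
  by (intro antimonoI le_weight weight_le) (rule reach_mono)

text \<open>
  The cost of opening \<open>v\<close>. On the event that the neighbours of \<open>v\<close> reach, through fresh sites, only
  points with \<open>\<phi> \<ge> c * \<phi> v\<close>, the weight drops at most by the factor \<open>c\<close>, because \<open>v\<close> itself already
  belongs to the cluster. Both this event and the weight are decreasing, and the Harris inequality
  separates them.
\<close>

lemma weight_insert_ge:
  assumes "finite U" "0 \<le> r" "r \<le> 1" "0 \<le> c" "c \<le> 1"
    and s: "\<And>u. u \<in> s \<Longrightarrow> reach s x u" and v: "reach s x v"
    and safe: "\<beta> \<le> bexp r U (\<lambda>S. of_bool (\<forall>w y. bonus v w \<longrightarrow> reach S w y \<longrightarrow> c * \<phi> v \<le> \<phi> y))"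
  shows "c * \<beta> * bexp r U (\<lambda>S. weight \<phi> x (s \<union> S)) \<le> bexp r U (\<lambda>S. weight \<phi> x (insert v s \<union> S))"
proof -
  define safe where "safe S = (\<forall>w y. bonus v w \<longrightarrow> reach S w y \<longrightarrow> c * \<phi> v \<le> \<phi> y)" for S
  have anti: "antimono (\<lambda>S. of_bool (safe S) :: real)"
    unfolding safe_def by (intro antimonoI) (auto simp: of_bool_def dest: reach_mono)
  have anti': "antimono (\<lambda>S. weight \<phi> x (s \<union> S))"
    by (intro antimonoI antimonoD[OF antimono_weight]) auto
  have pw: "c * (of_bool (safe S) * weight \<phi> x (s \<union> S)) \<le> weight \<phi> x (insert v s \<union> S)" for S
  proof (cases "safe S")
    case True
    have "c * weight \<phi> x (s \<union> S) \<le> weight \<phi> x (insert v s \<union> S)"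
    proof (rule le_weight)
      fix y assume "reach (insert v s \<union> S) x y"
      then consider "reach (s \<union> S) x y" | w where "bonus v w" "reach S w y"
        using reach_insert_fresh_tail s by fastforce
      then show "c * weight \<phi> x (s \<union> S) \<le> \<phi> y"
      proof cases
        case 1
        then have "weight \<phi> x (s \<union> S) \<le> \<phi> y" by (rule weight_le)
        then show ?thesis
          using mult_left_le_one_le[OF weight_nonneg] assms(4,5) by (meson order_trans)
      next
        case 2
        have "reach (s \<union> S) x v" using v by (rule reach_mono) auto
        then have "c * weight \<phi> x (s \<union> S) \<le> c * \<phi> v"
          using assms by (intro mult_left_mono weight_le) auto
        also have "\<dots> \<le> \<phi> y" using True 2 by (auto simp: safe_def)
        finally show ?thesis .
      qed
    qed
    then show ?thesis using True by simp
  qed (simp add: weight_nonneg)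
  have "c * (\<beta> * bexp r U (\<lambda>S. weight \<phi> x (s \<union> S)))
      \<le> c * (bexp r U (\<lambda>S. of_bool (safe S)) * bexp r U (\<lambda>S. weight \<phi> x (s \<union> S)))"
    using assms safe unfolding safe_def
    by (intro mult_left_mono mult_right_mono bexp_nonneg weight_nonneg) auto
  also have "\<dots> \<le> c * bexp r U (\<lambda>S. of_bool (safe S) * weight \<phi> x (s \<union> S))"
    using assms anti anti' by (intro mult_left_mono bexp_mult_ge_Harris) auto
  also have "\<dots> \<le> bexp r U (\<lambda>S. weight \<phi> x (insert v s \<union> S))"
    unfolding bexp_cmult[symmetric] using assms pw by (intro bexp_mono) auto
  finally show ?thesis by (simp add: mult.assoc)
qed

text \<open>
  The tilted law with density \<open>r'\<close> hits \<open>A\<close> at least as often as the law with density \<open>r\<close>, written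
  without division. The set \<open>s\<close> holds the sites found open so far and \<open>U\<close> the unexamined ones. The
  induction examines a site \<open>v\<close> of \<open>U\<close> that is already reached. Its tilted probability of being
  open is \<open>r' * w1 / (r' * w1 + (1 - r') * w0)\<close>, with \<open>w1\<close> and \<open>w0\<close> the mean weights when \<open>v\<close> is
  open and closed, and this is at least \<open>r\<close> because \<open>c * \<beta> * w0 \<le> w1\<close>. Since opening \<open>v\<close> can only help
  to hit \<open>A\<close>, raising this probability above \<open>r\<close> goes in the right direction.
\<close>

lemma tilted_exploration:
  assumes "finite U" "0 \<le> r" "r \<le> 1" "0 \<le> r'" "r' \<le> 1" "0 \<le> c" "c \<le> 1" and "r \<le> r' * (c * \<beta>)"
    and safe: "\<And>v V. v \<in> U \<Longrightarrow> V \<subseteq> U \<Longrightarrow>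
      \<beta> \<le> bexp r' V (\<lambda>S. of_bool (\<forall>w y. bonus v w \<longrightarrow> reach S w y \<longrightarrow> c * \<phi> v \<le> \<phi> y))"
    and s: "\<And>u. u \<in> s \<Longrightarrow> reach s x u"
  shows "bexp r U (\<lambda>S. of_bool (\<exists>y\<in>A. reach (s \<union> S) x y)) * bexp r' U (\<lambda>S. weight \<phi> x (s \<union> S))
    \<le> bexp r' U (\<lambda>S. of_bool (\<exists>y\<in>A. reach (s \<union> S) x y) * weight \<phi> x (s \<union> S))"
  using assms(1) safe s
proof (induction U arbitrary: s rule: finite_psubset_induct)
  case (psubset U)
  let ?h = "\<lambda>S. of_bool (\<exists>y\<in>A. reach S x y) :: real"
  let ?W = "weight \<phi> x"
  show ?case
  proof (cases "\<exists>v\<in>U. reach s x v")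
    case False
    \<comment> \<open>No unexamined site is reached, so the cluster no longer depends on the rest of the configuration.\<close>
    have "reach (s \<union> S) x y \<longleftrightarrow> reach s x y" if "S \<subseteq> U" for S y
    proof
      assume "reach (s \<union> S) x y"
      then show "reach s x y"
      proof (induction rule: reach_induct)
        case (bonus y z)
        then have "y \<in> s" using that False by auto
        then show ?case using bonus by (auto intro: reach_bonus)
      qed (auto intro: reach_base)
    qed (auto intro: reach_mono)
    then have "?h (s \<union> S) = ?h s" "?W (s \<union> S) = ?W s" if "S \<subseteq> U" for S
      using that by (auto simp: weight_def)
    then have "bexp q U (\<lambda>S. ?h (s \<union> S)) = ?h s" "bexp q U (\<lambda>S. ?W (s \<union> S)) = ?W s"
      "bexp q U (\<lambda>S. ?h (s \<union> S) * ?W (s \<union> S)) = ?h s * ?W s" for q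
      using psubset.hyps by (simp_all cong: bexp_cong)
    then show ?thesis by simp
  next
    case True
    then obtain v where v: "v \<in> U" "reach s x v" by auto
    define V where "V = U - {v}"
    have V: "finite V" "v \<notin> V" "U = insert v V" "V \<subset> U"
      using v psubset.hyps by (auto simp: V_def)
    have s': "reach (insert v s) x u" if "u \<in> insert v s" for u
      using that v psubset.prems(2) by (auto intro: reach_mono)
    define a1 a0 w1 w0 where
      "a1 = bexp r V (\<lambda>S. ?h (insert v s \<union> S))" and "a0 = bexp r V (\<lambda>S. ?h (s \<union> S))" and
      "w1 = bexp r' V (\<lambda>S. ?W (insert v s \<union> S))" and "w0 = bexp r' V (\<lambda>S. ?W (s \<union> S))"
    have split: "bexp q U (\<lambda>S. g (s \<union> S))
        = q * bexp q V (\<lambda>S. g (insert v s \<union> S)) + (1 - q) * bexp q V (\<lambda>S. g (s \<union> S))" for q g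
      unfolding V(3) using V by (simp add: bexp_insert)
    have "a1 * w1 \<le> bexp r' V (\<lambda>S. ?h (insert v s \<union> S) * ?W (insert v s \<union> S))"
      unfolding a1_def w1_def using s' V psubset.prems by (intro psubset.IH) auto
    moreover have "a0 * w0 \<le> bexp r' V (\<lambda>S. ?h (s \<union> S) * ?W (s \<union> S))"
      unfolding a0_def w0_def using V psubset.prems by (intro psubset.IH) auto
    ultimately have IH: "r' * (a1 * w1) + (1 - r') * (a0 * w0)
        \<le> bexp r' U (\<lambda>S. ?h (s \<union> S) * ?W (s \<union> S))"
      using assms unfolding split[of r' "\<lambda>S. ?h S * ?W S"] by (intro add_mono mult_left_mono) auto
    have a: "a0 \<le> a1"
      unfolding a0_def a1_def using assms
      by (intro bexp_mono) (auto simp: of_bool_def intro: reach_mono)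
    have w: "w1 \<le> w0"
      unfolding w0_def w1_def using assms
      by (intro bexp_mono antimonoD[OF antimono_weight]) auto
    have w0: "0 \<le> w0"
      unfolding w0_def using assms by (intro bexp_nonneg weight_nonneg) auto
    have cw: "c * \<beta> * w0 \<le> w1"
      unfolding w0_def w1_def using assms V v psubset.prems
      by (intro weight_insert_ge) auto
    have "r * (r' * w1 + (1 - r') * w0) \<le> r * w0"
      using w assms by (intro mult_left_mono convex_bound_le) auto
    also have "\<dots> \<le> r' * (c * \<beta>) * w0"
      using assms w0 by (intro mult_right_mono) auto
    also have "\<dots> \<le> r' * w1"
      using mult_left_mono[OF cw, of r'] assms by (simp add: mult.assoc)
    finally have "0 \<le> (a1 - a0) * (r' * w1 - r * (r' * w1 + (1 - r') * w0))"
      using a by simp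
    then have "(r * a1 + (1 - r) * a0) * (r' * w1 + (1 - r') * w0) \<le> r' * (a1 * w1) + (1 - r') * (a0 * w0)"
      by (simp add: algebra_simps)
    with IH show ?thesis
      unfolding split[of r ?h] split[of r' ?W] a1_def a0_def w1_def w0_def by linarith
  qed
qed

end

end

section \<open>Lattice events that depend on finitely many sites\<close>

definition open_sites :: "(int ^ 'd::finite \<Rightarrow> bool) \<Rightarrow> (int ^ 'd) set" where
  "open_sites \<omega> = {v. \<not> \<omega> v}"

lemma space_orthant_law [simp]: "space (orthant_law p) = UNIV"
  by (simp add: orthant_law_def space_PiM)

lemma prob_space_orthant_law: "prob_space (orthant_law p)"
  unfolding orthant_law_def by (intro prob_space_PiM measure_pmf.prob_space_axioms)

lemma orthant_law_cylinder:
  assumes "0 \<le> p" "p \<le> 1" "finite B" "S \<subseteq> B"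
  shows "{\<omega>. open_sites \<omega> \<inter> B = S} \<in> sets (orthant_law p)"
    and "measure (orthant_law p) {\<omega>. open_sites \<omega> \<inter> B = S}
      = (\<Prod>v\<in>B. if v \<in> S then 1 - p else 1 - (1 - p))"
proof -
  interpret product_prob_space "\<lambda>_. measure_pmf (bernoulli_pmf p)" UNIV
    by unfold_locales
  have eq: "{\<omega>. open_sites \<omega> \<inter> B = S}
      = prod_emb UNIV (\<lambda>_. measure_pmf (bernoulli_pmf p)) B (\<Pi>\<^sub>E v\<in>B. {v \<notin> S})"
    using assms(4) by (auto simp: prod_emb_def open_sites_def restrict_PiE_iff)
  show "{\<omega>. open_sites \<omega> \<inter> B = S} \<in> sets (orthant_law p)"
    unfolding eq orthant_law_def using assms by (intro sets_PiM_I) auto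
  show "measure (orthant_law p) {\<omega>. open_sites \<omega> \<inter> B = S}
      = (\<Prod>v\<in>B. if v \<in> S then 1 - p else 1 - (1 - p))"
    unfolding eq orthant_law_def using assms
    by (subst measure_PiM_emb) (auto simp: measure_pmf_single intro!: prod.cong)
qed

lemma orthant_law_finite_event:
  assumes "0 \<le> p" "p \<le> 1" "finite B"
  shows "{\<omega>. P (open_sites \<omega> \<inter> B)} \<in> sets (orthant_law p)"
    and "measure (orthant_law p) {\<omega>. P (open_sites \<omega> \<inter> B)} = bexp (1 - p) B (\<lambda>S. of_bool (P S))"
proof -
  interpret prob_space "orthant_law p" by (rule prob_space_orthant_law)
  let ?cyl = "\<lambda>S. {\<omega>. open_sites \<omega> \<inter> B = S}"
  have eq: "{\<omega>. P (open_sites \<omega> \<inter> B)} = (\<Union>S\<in>{S\<in>Pow B. P S}. ?cyl S)"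
    by auto
  have sets: "?cyl ` {S\<in>Pow B. P S} \<subseteq> sets (orthant_law p)"
    using orthant_law_cylinder(1)[OF assms] by auto
  then show "{\<omega>. P (open_sites \<omega> \<inter> B)} \<in> sets (orthant_law p)"
    unfolding eq using assms by (intro sets.finite_UN) auto
  have "measure (orthant_law p) {\<omega>. P (open_sites \<omega> \<inter> B)}
      = (\<Sum>S\<in>{S\<in>Pow B. P S}. measure (orthant_law p) (?cyl S))"
    unfolding eq using sets assms
    by (intro finite_measure_finite_Union) (auto simp: disjoint_family_on_def)
  also have "\<dots> = (\<Sum>S\<in>{S\<in>Pow B. P S}. (\<Prod>v\<in>B. if v \<in> S then 1 - p else 1 - (1 - p)) * of_bool (P S))"
    using orthant_law_cylinder(2)[OF assms] by (intro sum.cong) auto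
  also have "\<dots> = bexp (1 - p) B (\<lambda>S. of_bool (P S))"
    unfolding bexp_def using assms by (intro sum.mono_neutral_left) auto
  finally show "measure (orthant_law p) {\<omega>. P (open_sites \<omega> \<inter> B)} = bexp (1 - p) B (\<lambda>S. of_bool (P S))" .
qed

text \<open>
  The hypothesis on \<open>P\<close> says that it is increasing and that every occurrence is witnessed by a finite
  set. The event is then the increasing union of its versions in finite boxes, so bounds that are
  uniform over finite sets pass to the infinite lattice.
\<close>

lemma orthant_law_finitary_event:
  fixes P :: "(int ^ 'd::finite) set \<Rightarrow> bool"
  assumes "0 \<le> p" "p \<le> 1"
    and finitary: "\<And>S. P S \<longleftrightarrow> (\<exists>F\<subseteq>S. finite F \<and> P F)"
  shows "{\<omega>. P (open_sites \<omega>)} \<in> sets (orthant_law p)"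
    and "finite B \<Longrightarrow> bexp (1 - p) B (\<lambda>S. of_bool (P S)) \<le> measure (orthant_law p) {\<omega>. P (open_sites \<omega>)}"
    and "(\<And>B. finite B \<Longrightarrow> bexp (1 - p) B (\<lambda>S. of_bool (P S)) \<le> b)
      \<Longrightarrow> measure (orthant_law p) {\<omega>. P (open_sites \<omega>)} \<le> b"
proof -
  interpret prob_space "orthant_law p" by (rule prob_space_orthant_law)
  have mono: "P T" if "P S" "S \<subseteq> T" for S T
    using finitary[of S] finitary[of T] that by blast
  define box :: "nat \<Rightarrow> (int ^ 'd) set" where "box k = from_nat ` {..<k}" for k
  define E where "E k = {\<omega>. P (open_sites \<omega> \<inter> box k)}" for k
  have fin: "finite (box k)" for k
    by (simp add: box_def)
  have incseq: "incseq E"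
    unfolding E_def incseq_def box_def
    by (intro allI impI Collect_mono) (rule mono, assumption, auto)
  have bounded: "\<exists>k. F \<subseteq> box k" if "finite F" for F
  proof (intro exI subsetI)
    fix v assume "v \<in> F"
    then have "to_nat v < Suc (Max (to_nat ` F))"
      using that by (simp add: less_Suc_eq_le)
    then show "v \<in> box (Suc (Max (to_nat ` F)))"
      unfolding box_def by (intro image_eqI[of _ _ "to_nat v"]) auto
  qed
  have union: "{\<omega>. P (open_sites \<omega>)} = (\<Union>k. E k)"
  proof (intro equalityI subsetI)
    fix \<omega> assume "\<omega> \<in> {\<omega>. P (open_sites \<omega>)}"
    then obtain F where F: "F \<subseteq> open_sites \<omega>" "finite F" "P F"
      using finitary[of "open_sites \<omega>"] by auto
    obtain k where "F \<subseteq> box k" using bounded[OF F(2)] by auto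
    then show "\<omega> \<in> (\<Union>k. E k)" using F by (auto simp: E_def intro!: exI[of _ k] mono[of F])
  qed (auto simp: E_def intro: mono)
  have meas: "E k \<in> sets (orthant_law p)" for k
    unfolding E_def using assms fin by (intro orthant_law_finite_event)
  show sets: "{\<omega>. P (open_sites \<omega>)} \<in> sets (orthant_law p)"
    unfolding union using meas by auto
  show "bexp (1 - p) B (\<lambda>S. of_bool (P S)) \<le> measure (orthant_law p) {\<omega>. P (open_sites \<omega>)}" if "finite B"
    unfolding orthant_law_finite_event(2)[OF assms(1,2) that, symmetric]
    by (intro finite_measure_mono sets) (auto intro: mono)
  have "(\<lambda>k. prob (E k)) \<longlonglongrightarrow> prob (\<Union>k. E k)"
    using meas incseq by (intro finite_Lim_measure_incseq) auto
  moreover assume "bexp (1 - p) B (\<lambda>S. of_bool (P S)) \<le> b" if "finite B" for B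
  then have "prob (E k) \<le> b" for k
    unfolding E_def orthant_law_finite_event(2)[OF assms(1,2) fin] using fin by blast
  ultimately show "prob {\<omega>. P (open_sites \<omega>)} \<le> b"
    unfolding union by (intro LIMSEQ_le_const2) auto
qed

section \<open>Levels of the cone\<close>

lemma mem_shifted_cone_iff: "x \<in> shifted_cone n \<eta> \<longleftrightarrow> x + real n *\<^sub>R 1 \<in> cone \<eta>"
proof
  assume "x + real n *\<^sub>R 1 \<in> cone \<eta>"
  moreover have "x = - (real n *\<^sub>R 1) + (x + real n *\<^sub>R 1)"
    by simp
  ultimately show "x \<in> shifted_cone n \<eta>"
    unfolding shifted_cone_def by (rule rev_image_eqI)
qed (auto simp: shifted_cone_def)

lemma mem_cone_iff: "x \<in> cone \<eta> \<longleftrightarrow> \<eta> * (\<Sum>i\<in>UNIV. \<bar>x $ i\<bar>) \<le> (\<Sum>i\<in>UNIV. x $ i)"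
  by (simp add: cone_def l1_norm_def inner_vec_def)

text \<open>
  The cone is convex; this is what makes the level subadditive.
\<close>

lemma cone_add:
  assumes "0 \<le> \<eta>" "x \<in> cone \<eta>" "y \<in> cone \<eta>"
  shows "x + y \<in> cone \<eta>"
proof -
  have "(\<Sum>i\<in>UNIV. \<bar>(x + y) $ i\<bar>) \<le> (\<Sum>i\<in>UNIV. \<bar>x $ i\<bar>) + (\<Sum>i\<in>UNIV. \<bar>y $ i\<bar>)"
    unfolding sum.distrib[symmetric] by (intro sum_mono) simp
  then have "\<eta> * (\<Sum>i\<in>UNIV. \<bar>(x + y) $ i\<bar>) \<le> \<eta> * (\<Sum>i\<in>UNIV. \<bar>x $ i\<bar>) + \<eta> * (\<Sum>i\<in>UNIV. \<bar>y $ i\<bar>)"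
    unfolding distrib_left[symmetric] using assms by (intro mult_left_mono)
  then show ?thesis using assms by (simp add: mem_cone_iff sum.distrib)
qed

lemma nonneg_in_cone:
  assumes "\<eta> \<le> 1" "\<And>i. 0 \<le> x $ i"
  shows "x \<in> cone \<eta>"
  using assms mult_right_mono[of \<eta> 1 "\<Sum>i\<in>UNIV. x $ i"] by (simp add: mem_cone_iff sum_nonneg)

lemma shifted_cone_mono:
  assumes "0 \<le> \<eta>" "\<eta> \<le> 1" "m \<le> n" "x \<in> shifted_cone m \<eta>"
  shows "x \<in> shifted_cone n \<eta>"
proof -
  have "(x + real m *\<^sub>R 1) + real (n - m) *\<^sub>R 1 \<in> cone \<eta>"
    using assms nonneg_in_cone[of \<eta> "real (n - m) *\<^sub>R 1"]
    by (intro cone_add[of _ "x + real m *\<^sub>R 1"]) (auto simp: mem_shifted_cone_iff)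
  moreover have "(x + real m *\<^sub>R 1) + real (n - m) *\<^sub>R 1 = x + real n *\<^sub>R (1 :: real ^ _)"
    using assms(3) by (simp add: vec_eq_iff of_nat_diff)
  ultimately show ?thesis by (simp add: mem_shifted_cone_iff)
qed

text \<open>
  Leaving the shifted cone \<open>n\<close> means reaching a site of level greater than \<open>n\<close>, so one function
  records all the escape events.
\<close>

definition level :: "real \<Rightarrow> int ^ 'd::finite \<Rightarrow> nat" where
  "level \<eta> y = (LEAST n. to_real_vec y \<in> shifted_cone n \<eta>)"

lemma to_real_vec_nth [simp]: "to_real_vec v $ i = of_int (v $ i)"
  by (simp add: to_real_vec_def)

context
  fixes \<eta> :: real
  assumes eta: "0 \<le> \<eta>" "\<eta> < 1"
begin

text \<open>
  This is where \<open>\<eta> < 1\<close> enters: the vector \<open>1\<close> lies in the interior of the cone, so a large enough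
  multiple of it moves any point into the cone.
\<close>

lemma ex_shifted_cone:
  fixes x :: "real ^ 'd::finite"
  shows "\<exists>n. x \<in> shifted_cone n \<eta>"
proof -
  define L where "L = (\<Sum>i\<in>UNIV. \<bar>x $ i\<bar>)"
  obtain n where n: "2 * L / (1 - \<eta>) \<le> real n"
    using real_arch_simple by blast
  have L: "0 \<le> L" "- L \<le> (\<Sum>i\<in>UNIV. x $ i)"
    unfolding L_def sum_negf[symmetric] by (auto intro!: sum_nonneg sum_mono)
  have "2 * L \<le> real n * (1 - \<eta>)"
    using n eta by (simp add: pos_divide_le_eq)
  also have "\<dots> \<le> real CARD('d) * (real n * (1 - \<eta>))"
  proof -
    have "1 \<le> real CARD('d)" by (simp add: Suc_le_eq)
    then have "1 * (real n * (1 - \<eta>)) \<le> real CARD('d) * (real n * (1 - \<eta>))"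
      using eta by (intro mult_right_mono) simp_all
    then show ?thesis by simp
  qed
  finally have n': "2 * L \<le> real CARD('d) * real n - \<eta> * (real CARD('d) * real n)"
    by (simp add: algebra_simps)
  have "(\<Sum>i\<in>UNIV. \<bar>(x + real n *\<^sub>R 1) $ i\<bar>) \<le> (\<Sum>i\<in>UNIV. \<bar>x $ i\<bar> + real n)"
    by (intro sum_mono) simp
  also have "\<dots> = L + real CARD('d) * real n"
    by (simp add: L_def sum.distrib)
  finally have "\<eta> * (\<Sum>i\<in>UNIV. \<bar>(x + real n *\<^sub>R 1) $ i\<bar>) \<le> \<eta> * (L + real CARD('d) * real n)"
    using eta by (intro mult_left_mono) simp_all
  also have "\<dots> = \<eta> * L + \<eta> * (real CARD('d) * real n)"
    by (rule distrib_left)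
  also have "\<dots> \<le> L + \<eta> * (real CARD('d) * real n)"
    using mult_right_mono[of \<eta> 1 L] L eta by linarith
  also have "\<dots> \<le> - L + real CARD('d) * real n"
    using n' by linarith
  also have "\<dots> \<le> (\<Sum>i\<in>UNIV. (x + real n *\<^sub>R 1) $ i)"
    using L by (simp add: sum.distrib)
  finally have "x \<in> shifted_cone n \<eta>"
    unfolding mem_shifted_cone_iff mem_cone_iff .
  then show ?thesis ..
qed

lemma level_le_iff: "level \<eta> y \<le> n \<longleftrightarrow> to_real_vec y \<in> shifted_cone n \<eta>"
proof
  have "to_real_vec y \<in> shifted_cone (level \<eta> y) \<eta>"
    unfolding level_def using ex_shifted_cone by (rule LeastI_ex)
  then show "to_real_vec y \<in> shifted_cone n \<eta>" if "level \<eta> y \<le> n"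
    using that eta by (auto elim: shifted_cone_mono[rotated 3])
qed (simp add: level_def Least_le)

lemma level_add_le: "level \<eta> (x + y) \<le> level \<eta> x + level \<eta> y"
proof -
  have "(to_real_vec x + real (level \<eta> x) *\<^sub>R 1) + (to_real_vec y + real (level \<eta> y) *\<^sub>R 1) \<in> cone \<eta>"
    using level_le_iff[of x "level \<eta> x"] level_le_iff[of y "level \<eta> y"] eta
    by (intro cone_add[of _ "to_real_vec x + real (level \<eta> x) *\<^sub>R 1"])
      (simp_all add: mem_shifted_cone_iff)
  also have "(to_real_vec x + real (level \<eta> x) *\<^sub>R 1) + (to_real_vec y + real (level \<eta> y) *\<^sub>R 1)
      = to_real_vec (x + y) + real (level \<eta> x + level \<eta> y) *\<^sub>R 1"
    by (simp add: vec_eq_iff)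
  finally show ?thesis
    unfolding level_le_iff mem_shifted_cone_iff .
qed

lemma level_eq_0:
  assumes "\<And>i. 0 \<le> y $ i"
  shows "level \<eta> y = 0"
proof -
  have "to_real_vec y + real 0 *\<^sub>R 1 \<in> cone \<eta>"
    using eta assms by (intro nonneg_in_cone) auto
  then have "level \<eta> y \<le> 0"
    unfolding level_le_iff mem_shifted_cone_iff .
  then show ?thesis by simp
qed

text \<open>
  The complement of a shifted cone is closed under lowering coordinates.
\<close>

lemma level_antimono:
  assumes "\<And>i. x $ i \<le> y $ i"
  shows "level \<eta> y \<le> level \<eta> x"
proof -
  have "level \<eta> (y - x) = 0"
    using assms by (intro level_eq_0) simp
  then show ?thesis
    using level_add_le[of x "y - x"] by simp
qed

text \<open>
  If the coordinates of \<open>u\<close> are nonnegative with a sum that is large compared to \<open>N\<close>, then even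
  \<open>u - N *\<^sub>R 1\<close> lies in the cone, which compensates for the \<open>N\<close> levels lost by \<open>z\<close>.
\<close>

lemma level_eq_0_deep:
  fixes u z :: "int ^ 'd::finite"
  assumes u: "\<And>i. 0 \<le> u $ i"
    and deep: "2 * real CARD('d) * real N \<le> real_of_int (\<Sum>i\<in>UNIV. u $ i) * (1 - \<eta>)"
    and z: "level \<eta> z \<le> N"
  shows "level \<eta> (u + z) = 0"
proof -
  define t where "t = real_of_int (\<Sum>i\<in>UNIV. u $ i)"
  let ?u = "to_real_vec u - real N *\<^sub>R 1"
  have "(\<Sum>i\<in>UNIV. \<bar>?u $ i\<bar>) \<le> (\<Sum>i\<in>UNIV. of_int (u $ i) + real N)"
    using u by (intro sum_mono) (auto simp: abs_if)
  also have "\<dots> = t + real CARD('d) * real N"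
    by (simp add: t_def sum.distrib)
  finally have "\<eta> * (\<Sum>i\<in>UNIV. \<bar>?u $ i\<bar>) \<le> \<eta> * (t + real CARD('d) * real N)"
    using eta by (intro mult_left_mono)
  also have "\<dots> \<le> \<eta> * t + 1 * (real CARD('d) * real N)"
    unfolding distrib_left using eta by (intro add_left_mono mult_right_mono) auto
  also have "\<dots> \<le> t - real CARD('d) * real N"
    using deep unfolding t_def[symmetric] by (simp add: algebra_simps)
  also have "\<dots> = (\<Sum>i\<in>UNIV. ?u $ i)"
    by (simp add: t_def sum_subtractf)
  finally have "?u \<in> cone \<eta>"
    by (simp add: mem_cone_iff)
  then have "?u + (to_real_vec z + real N *\<^sub>R 1) \<in> cone \<eta>"
    using z eta by (intro cone_add[of _ ?u]) (simp_all add: level_le_iff mem_shifted_cone_iff)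
  also have "?u + (to_real_vec z + real N *\<^sub>R 1) = to_real_vec (u + z) + real 0 *\<^sub>R 1"
    by (simp add: vec_eq_iff)
  finally have "level \<eta> (u + z) \<le> 0"
    unfolding level_le_iff mem_shifted_cone_iff .
  then show ?thesis by simp
qed

lemma level_minus_axis_le: "level \<eta> (- axis i 1) \<le> 1"
  unfolding level_le_iff mem_shifted_cone_iff
  using eta by (intro nonneg_in_cone) (auto simp: axis_def)

end

section \<open>The half-orthant model\<close>

interpretation half: bonus_digraph
  "\<lambda>v w :: int ^ 'd::finite. \<exists>i. w = v + axis i 1" "\<lambda>v w. \<exists>i. w = v - axis i 1" .

lemma connects_imp_half_reach:
  assumes "connects \<omega> x y"
  shows "half.reach (open_sites \<omega>) x y"
  using assms unfolding connects_def
proof (induction rule: rtranclp_induct)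
  case (step y z)
  show ?case
  proof (cases "\<omega> y")
    case True
    then obtain i where "z = y + axis i 1"
      using step.hyps(2) by (auto simp: orthant_edge_def unit_pos_def)
    then show ?thesis using step.IH half.reach_base by blast
  next
    case False
    then obtain i where "z = y - axis i 1"
      using step.hyps(2) by (auto simp: orthant_edge_def unit_pos_def unit_neg_def)
    then show ?thesis using step.IH False half.reach_bonus by (force simp: open_sites_def)
  qed
qed simp

lemma connects_pos: "connects \<omega> x y \<Longrightarrow> \<omega> y \<Longrightarrow> connects \<omega> x (y + axis i 1)"
  unfolding connects_def
  by (erule rtranclp.rtrancl_into_rtrancl) (auto simp: orthant_edge_def unit_pos_def)

lemma connects_neg: "connects \<omega> x y \<Longrightarrow> \<not> \<omega> y \<Longrightarrow> connects \<omega> x (y - axis i 1)"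
  unfolding connects_def
  by (erule rtranclp.rtrancl_into_rtrancl) (auto simp: orthant_edge_def unit_neg_def unit_pos_def)

text \<open>
  Starting below an open site \<open>y\<close>, follow positive edges in coordinates in which the position is
  still smaller than \<open>y\<close>, until an open site is met. This happens at \<open>y\<close> at the latest.
\<close>

lemma connects_climb_to_open:
  assumes "connects \<omega> z x" "\<And>i. x $ i \<le> y $ i" "\<not> \<omega> y"
  shows "\<exists>x'. connects \<omega> z x' \<and> (\<forall>i. x' $ i \<le> y $ i) \<and> \<not> \<omega> x'"
  using assms(1,2)
proof (induction "nat (\<Sum>i\<in>UNIV. y $ i - x $ i)" arbitrary: x rule: less_induct)
  case less
  show ?case
  proof (cases "\<omega> x")
    case True
    then have "x \<noteq> y" using assms by auto
    then obtain i where i: "x $ i < y $ i"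
      using less.prems(2) by (metis vec_eq_iff order_less_le)
    then have le: "(x + axis i 1) $ j \<le> y $ j" for j
      using less.prems(2)[of j] by (auto simp: axis_def)
    have "(\<Sum>j\<in>UNIV. y $ j - (x + axis i 1) $ j) < (\<Sum>j\<in>UNIV. y $ j - x $ j)"
      by (intro sum_strict_mono_ex1) (auto simp: axis_def intro: exI[of _ i])
    moreover have "0 \<le> (\<Sum>j\<in>UNIV. y $ j - (x + axis i 1) $ j)"
      using le by (intro sum_nonneg) (simp del: vector_add_component)
    ultimately have "nat (\<Sum>j\<in>UNIV. y $ j - (x + axis i 1) $ j) < nat (\<Sum>j\<in>UNIV. y $ j - x $ j)"
      by simp
    then show ?thesis
      using less.hyps less.prems(1) True le connects_pos by blast
  qed (use less.prems in blast)
qed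

text \<open>
  An orthant path can stay below a given half-orthant path: positive steps of the latter are
  ignored, and before it makes a negative step the former climbs to an open site, from which it can
  make the same step.
\<close>

lemma half_reach_imp_connects_below:
  assumes "half.reach (open_sites \<omega>) z y"
  shows "\<exists>x. connects \<omega> z x \<and> (\<forall>i. x $ i \<le> y $ i)"
  using assms
proof (induction rule: half.reach_induct)
  case refl
  show ?case by (rule exI[of _ z]) (simp add: connects_def)
next
  case (base y y')
  then obtain x i where "connects \<omega> z x" "\<forall>i. x $ i \<le> y $ i" "y' = y + axis i 1" by auto
  then show ?case by (intro exI[of _ x]) (auto simp: axis_def intro: order_trans)
next
  case (bonus y y')
  then obtain x i where x: "connects \<omega> z x" "\<forall>i. x $ i \<le> y $ i" and y': "y' = y - axis i 1" by auto
  have "\<not> \<omega> y" using bonus by (simp add: open_sites_def)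
  then obtain x' where "connects \<omega> z x'" "\<forall>i. x' $ i \<le> y $ i" "\<not> \<omega> x'"
    using connects_climb_to_open x by blast
  then show ?case
    using y' by (intro exI[of _ "x' - axis i 1"]) (auto simp: connects_neg)
qed

section \<open>Escape probabilities\<close>

text \<open>
  The level is measured relative to the starting point, so that the probability does not depend
  on it.
\<close>

definition escapes :: "real \<Rightarrow> nat \<Rightarrow> int ^ 'd::finite \<Rightarrow> (int ^ 'd) set \<Rightarrow> bool" where
  "escapes \<eta> n x S \<longleftrightarrow> (\<exists>y. half.reach S x y \<and> n < level \<eta> (y - x))"

definition escape_prob :: "'d::finite itself \<Rightarrow> real \<Rightarrow> real \<Rightarrow> nat \<Rightarrow> real" where
  "escape_prob _ p \<eta> n = measure (orthant_law p) {\<omega> :: int ^ 'd \<Rightarrow> bool. escapes \<eta> n 0 (open_sites \<omega>)}"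

lemma escapes_mono: "escapes \<eta> n x S \<Longrightarrow> S \<subseteq> T \<Longrightarrow> escapes \<eta> n x T"
  unfolding escapes_def using half.reach_mono by blast

lemma escapes_finitary: "escapes \<eta> n x S \<longleftrightarrow> (\<exists>F\<subseteq>S. finite F \<and> escapes \<eta> n x F)"
proof
  assume "escapes \<eta> n x S"
  then obtain y where y: "half.reach S x y" "n < level \<eta> (y - x)"
    by (auto simp: escapes_def)
  from y(1) obtain F where "finite F" "F \<subseteq> S" "half.reach F x y"
    by (rule half.reach_finite)
  then show "\<exists>F\<subseteq>S. finite F \<and> escapes \<eta> n x F"
    using y(2) by (auto simp: escapes_def)
qed (auto dest: escapes_mono)

lemma escapes_antimono: "escapes \<eta> n x S \<Longrightarrow> m \<le> n \<Longrightarrow> escapes \<eta> m x S"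
  unfolding escapes_def by (meson le_less_trans)

text \<open>
  Escaping is witnessed by a finite path, so it is an event with finite approximations.
\<close>

lemmas escapes_event =
  orthant_law_finitary_event[where P = "escapes \<eta> n x" for \<eta> n x, OF _ _ escapes_finitary]

lemma half_reach_translate:
  "half.reach S x y \<Longrightarrow> half.reach ((+) a ` S) (a + x) (a + y)"
proof (induction rule: half.reach_induct)
  case (base y z)
  then show ?case using half.reach_base[of _ _ "a + y" "a + z"] by (auto simp: add.assoc)
next
  case (bonus y z)
  then show ?case using half.reach_bonus[of _ _ "a + y" "a + z"] by (auto simp: add_diff_eq)
qed simp

lemma escapes_translate: "escapes \<eta> n x S \<Longrightarrow> escapes \<eta> n (a + x) ((+) a ` S)"
  unfolding escapes_def using half_reach_translate[of S x _ a] by fastforce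

text \<open>
  Translating the finite set \<open>B\<close> replaces translation invariance of the product measure.
\<close>

lemma bexp_escapes_le_escape_prob:
  fixes x :: "int ^ 'd::finite"
  assumes "0 \<le> p" "p \<le> 1" "finite B"
  shows "bexp (1 - p) B (\<lambda>S. of_bool (escapes \<eta> n x S)) \<le> escape_prob TYPE('d) p \<eta> n"
proof -
  have "bexp (1 - p) B (\<lambda>S. of_bool (escapes \<eta> n x S))
      \<le> bexp (1 - p) B (\<lambda>S. of_bool (escapes \<eta> n 0 ((+) (- x) ` S)))"
    using assms escapes_translate[of \<eta> n x _ "- x"] by (intro bexp_mono) (simp_all add: of_bool_def)
  also have "\<dots> = bexp (1 - p) ((+) (- x) ` B) (\<lambda>S. of_bool (escapes \<eta> n 0 S))"
    by (subst bexp_image) auto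
  also have "\<dots> \<le> escape_prob TYPE('d) p \<eta> n"
    unfolding escape_prob_def
    by (rule escapes_event(2)[OF assms(1,2)]) (intro finite_imageI assms(3))
  finally show ?thesis .
qed

lemma escape_prob_leI:
  assumes "0 \<le> p" "p \<le> 1"
    and "\<And>B. finite B \<Longrightarrow> bexp (1 - p) B (\<lambda>S. of_bool (escapes \<eta> n (0 :: int ^ 'd::finite) S)) \<le> b"
  shows "escape_prob TYPE('d) p \<eta> n \<le> b"
  unfolding escape_prob_def
  by (rule escapes_event(3)[OF assms(1,2)]) (rule assms(3))

lemma bounded_cluster_measurable:
  assumes "0 \<le> p" "p \<le> 1"
  shows "{\<omega>. \<exists>n. \<not> escapes \<eta> n x (open_sites \<omega>)} \<in> sets (orthant_law p)"
proof -
  have eq: "{\<omega>. \<exists>n. \<not> escapes \<eta> n x (open_sites \<omega>)}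
      = (\<Union>n. space (orthant_law p) - {\<omega>. escapes \<eta> n x (open_sites \<omega>)})"
    by auto
  have "space (orthant_law p) - {\<omega>. escapes \<eta> n x (open_sites \<omega>)} \<in> sets (orthant_law p)" for n
    by (rule sets.compl_sets) (rule escapes_event(1)[OF assms])
  then have "range (\<lambda>n. space (orthant_law p) - {\<omega>. escapes \<eta> n x (open_sites \<omega>)}) \<subseteq> sets (orthant_law p)"
    by blast
  then show ?thesis
    unfolding eq by (rule sets.countable_UN)
qed

context
  fixes \<eta> :: real
  assumes eta: "0 \<le> \<eta>" "\<eta> < 1"
begin

lemma connects_set_iff_escapes:
  "connects_set \<omega> 0 (- shifted_cone n \<eta>) \<longleftrightarrow> escapes \<eta> n 0 (open_sites \<omega>)"
proof
  assume "connects_set \<omega> 0 (- shifted_cone n \<eta>)"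
  then obtain y where "connects \<omega> 0 y" "\<not> level \<eta> y \<le> n"
    by (auto simp: connects_set_def level_le_iff[OF eta])
  then show "escapes \<eta> n 0 (open_sites \<omega>)"
    unfolding escapes_def by (intro exI[of _ y]) (auto intro: connects_imp_half_reach)
next
  assume "escapes \<eta> n 0 (open_sites \<omega>)"
  then obtain y where "half.reach (open_sites \<omega>) 0 y" "n < level \<eta> y"
    by (auto simp: escapes_def)
  then obtain x where x: "connects \<omega> 0 x" "\<And>i. x $ i \<le> y $ i"
    using half_reach_imp_connects_below by blast
  have "\<not> level \<eta> x \<le> n"
    using level_antimono[OF eta x(2)] \<open>n < level \<eta> y\<close> by simp
  then show "connects_set \<omega> 0 (- shifted_cone n \<eta>)"
    using x by (auto simp: connects_set_def level_le_iff[OF eta])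
qed

lemma cluster_in_shifted_cone_iff:
  "to_real_vec ` forward_cluster \<omega> 0 \<subseteq> shifted_cone n \<eta> \<longleftrightarrow> \<not> escapes \<eta> n 0 (open_sites \<omega>)"
  unfolding connects_set_iff_escapes[symmetric]
  by (auto simp: connects_set_def forward_cluster_def)

lemma escape_prob_tendsto_0:
  assumes "0 \<le> q" "q \<le> 1"
    and "measure (orthant_law q) {\<omega> :: int ^ 'd::finite \<Rightarrow> bool. \<exists>n. \<not> escapes \<eta> n 0 (open_sites \<omega>)} = 1"
  shows "escape_prob TYPE('d) q \<eta> \<longlonglongrightarrow> 0"
proof -
  interpret prob_space "orthant_law q :: (int ^ 'd \<Rightarrow> bool) measure" by (rule prob_space_orthant_law)
  let ?E = "\<lambda>n. {\<omega> :: int ^ 'd \<Rightarrow> bool. escapes \<eta> n 0 (open_sites \<omega>)}"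
  have sets: "?E n \<in> events" for n
    by (intro escapes_event(1) assms)
  have "decseq ?E"
    unfolding decseq_def by (auto intro: escapes_antimono)
  then have "(\<lambda>n. prob (?E n)) \<longlonglongrightarrow> prob (\<Inter>n. ?E n)"
    using sets by (intro finite_Lim_measure_decseq) auto
  also have "(\<Inter>n. ?E n) = space (orthant_law q) - {\<omega>. \<exists>n. \<not> escapes \<eta> n 0 (open_sites \<omega>)}"
    by auto
  also have "prob \<dots> = 0"
    using bounded_cluster_measurable[OF assms(1,2), of \<eta> "0 :: int ^ 'd"] assms(3)
    by (subst prob_compl) auto
  finally show ?thesis by (simp add: escape_prob_def[abs_def])
qed

section \<open>Exponential decay\<close>

text \<open>
  The exploration comparison with \<open>\<phi> y = exp (- \<kappa> h y)\<close>. The constants satisfy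
  \<open>r = r' * (1 - 2 * \<epsilon>)\<close>; of the two losses \<open>\<epsilon>\<close> one pays for the exceptional event at the neighbours
  of the examined site and one for the factor \<open>exp (- \<kappa> * (N + 1))\<close>.
\<close>

lemma escape_prob_exp_decay:
  assumes "0 \<le> q" "q < p" "p \<le> 1"
    and lim: "escape_prob TYPE('d::finite) q \<eta> \<longlonglongrightarrow> 0"
  shows "\<exists>C>0. \<exists>\<kappa>>0. \<forall>n. escape_prob TYPE('d) p \<eta> n \<le> C * exp (- \<kappa> * real n)"
proof -
  define r r' \<epsilon> where "r = 1 - p" and "r' = 1 - q" and "\<epsilon> = (1 - r / r') / 2"
  have r: "0 \<le> r" "r < r'" "r' \<le> 1" "r \<le> 1" "0 \<le> r'"
    using assms by (auto simp: r_def r'_def)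
  then have \<epsilon>: "0 < \<epsilon>" "\<epsilon> \<le> 1 / 2" "r = r' * (1 - 2 * \<epsilon>)"
    by (auto simp: \<epsilon>_def field_simps)
  have "eventually (\<lambda>n. escape_prob TYPE('d) q \<eta> n < \<epsilon> / CARD('d)) sequentially"
    using \<epsilon> by (intro order_tendstoD(2)[OF lim]) auto
  then obtain N where N: "escape_prob TYPE('d) q \<eta> N < \<epsilon> / CARD('d)"
    by (auto simp: eventually_sequentially)
  define \<kappa> \<phi> c where "\<kappa> = \<epsilon> / (real N + 1)" and "\<phi> y = exp (- \<kappa> * real (level \<eta> y))"
    and "c = exp (- \<epsilon>)" for y :: "int ^ 'd"
  have \<kappa>: "0 < \<kappa>" "\<kappa> * (real N + 1) = \<epsilon>"
    using \<epsilon> by (auto simp: \<kappa>_def)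
  have c: "1 - \<epsilon> \<le> c" "c \<le> 1" "0 \<le> c"
    using exp_ge_add_one_self[of "- \<epsilon>"] \<epsilon> by (auto simp: c_def)
  have "1 - 2 * \<epsilon> \<le> (1 - \<epsilon>) * (1 - \<epsilon>)"
    by (simp add: algebra_simps)
  also have "\<dots> \<le> c * (1 - \<epsilon>)"
    using c \<epsilon> by (intro mult_right_mono) auto
  finally have r_le: "r \<le> r' * (c * (1 - \<epsilon>))"
    unfolding \<epsilon>(3) using r by (intro mult_left_mono) auto
  have close: "c * \<phi> v \<le> \<phi> y" if "level \<eta> y \<le> level \<eta> v + 1 + N" for v y
  proof -
    have "\<kappa> * real (level \<eta> y) \<le> \<kappa> * (real (level \<eta> v) + (real N + 1))"
      using that \<kappa> by (intro mult_left_mono) auto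
    then show ?thesis
      using \<kappa> by (simp add: \<phi>_def c_def distrib_left flip: exp_add)
  qed
  have escapeN: "bexp r' V (\<lambda>S. of_bool (escapes \<eta> N x S)) \<le> \<epsilon> / CARD('d)"
    if "finite V" for V and x :: "int ^ 'd"
    using bexp_escapes_le_escape_prob[of q V \<eta> N x] that N assms by (simp add: r'_def)
  \<comment> \<open>A union bound over the neighbours of the examined site.\<close>
  have safe: "1 - \<epsilon> \<le> bexp r' V (\<lambda>S. of_bool (\<forall>w y. (\<exists>i. w = v - axis i 1) \<longrightarrow>
      half.reach S w y \<longrightarrow> c * \<phi> v \<le> \<phi> y))" if "finite V" for V v
  proof -
    have step: "c * \<phi> v \<le> \<phi> y"
      if "\<not> escapes \<eta> N (v - axis i 1) S" "half.reach S (v - axis i 1) y" for S y i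
    proof (rule close)
      have "level \<eta> y \<le> level \<eta> (v + - axis i 1) + level \<eta> (y - (v - axis i 1))"
        using level_add_le[OF eta, of "v + - axis i 1" "y - (v - axis i 1)"] by simp
      also have "level \<eta> (v + - axis i 1) \<le> level \<eta> v + 1"
        using level_add_le[OF eta, of v "- axis i 1"] level_minus_axis_le[OF eta, of i] by simp
      also have "level \<eta> (y - (v - axis i 1)) \<le> N"
        using that by (auto simp: escapes_def not_less)
      finally show "level \<eta> y \<le> level \<eta> v + 1 + N" by simp
    qed
    have "(\<Sum>i\<in>UNIV. bexp r' V (\<lambda>S. of_bool (escapes \<eta> N (v - axis i 1) S))) \<le> (\<Sum>i\<in>(UNIV :: 'd set). \<epsilon> / CARD('d))"
      using that by (intro sum_mono escapeN)
    then have "1 - \<epsilon> \<le> bexp r' V (\<lambda>S. 1 - (\<Sum>i\<in>UNIV. of_bool (escapes \<eta> N (v - axis i 1) S)))"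
      unfolding bexp_diff bexp_sum using that by simp
    also have "\<dots> \<le> bexp r' V (\<lambda>S. of_bool (\<forall>w y. (\<exists>i. w = v - axis i 1) \<longrightarrow>
      half.reach S w y \<longrightarrow> c * \<phi> v \<le> \<phi> y))"
    proof (rule bexp_mono)
      fix S
      show "1 - (\<Sum>i\<in>UNIV. of_bool (escapes \<eta> N (v - axis i 1) S))
        \<le> (of_bool (\<forall>w y. (\<exists>i. w = v - axis i 1) \<longrightarrow> half.reach S w y \<longrightarrow> c * \<phi> v \<le> \<phi> y) :: real)"
      proof (cases "\<exists>i. escapes \<eta> N (v - axis i 1) S")
        case True
        then obtain i where "escapes \<eta> N (v - axis i 1) S" ..
        then have "(1 :: real) \<le> (\<Sum>i\<in>UNIV. of_bool (escapes \<eta> N (v - axis i 1) S))"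
          using member_le_sum[of i UNIV "\<lambda>i. of_bool (escapes \<eta> N (v - axis i 1) S) :: real"] by simp
        then show ?thesis by (simp add: of_bool_def)
      next
        case False
        then have "\<forall>w y. (\<exists>i. w = v - axis i 1) \<longrightarrow> half.reach S w y \<longrightarrow> c * \<phi> v \<le> \<phi> y"
          using step by blast
        then show ?thesis using False by simp
      qed
    qed (use r in auto)
    finally show ?thesis .
  qed
  \<comment> \<open>The mean weight is bounded below uniformly in the finite set, and it is small on the escape event.\<close>
  have bound: "bexp r B (\<lambda>S. of_bool (escapes \<eta> n (0 :: int ^ 'd) S)) \<le> 1 / (c * (1 - \<epsilon>)) * exp (- \<kappa> * real n)"
    if B: "finite B" for B n
  proof -
    let ?W = "half.weight \<phi> 0"
    have pos: "0 \<le> \<phi> y" for y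
      by (simp add: \<phi>_def)
    have "c * (1 - \<epsilon>) \<le> c * bexp r' B (\<lambda>S. of_bool (\<not> escapes \<eta> N 0 S))"
    proof -
      have "\<epsilon> / CARD('d) \<le> \<epsilon> / 1"
        using \<epsilon> by (intro divide_left_mono) (auto simp: Suc_le_eq)
      then show ?thesis
        using escapeN[OF B, of 0] c \<epsilon> by (intro mult_left_mono) (auto simp: bexp_not[OF B])
    qed
    also have "\<dots> \<le> bexp r' B ?W"
      unfolding bexp_cmult[symmetric]
    proof (rule bexp_mono)
      fix S
      show "c * of_bool (\<not> escapes \<eta> N 0 S) \<le> ?W S"
      proof (cases "escapes \<eta> N 0 S")
        case False
        have "c \<le> \<phi> y" if "half.reach S 0 y" for y
          using False that close[of y 0]
          by (auto simp: escapes_def not_less \<phi>_def level_eq_0[OF eta])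
        then show ?thesis using False by (auto intro: half.le_weight pos)
      qed (simp add: half.weight_nonneg pos)
    qed (use r in auto)
    finally have W: "c * (1 - \<epsilon>) \<le> bexp r' B ?W" .
    have "bexp r B (\<lambda>S. of_bool (escapes \<eta> n 0 S)) * bexp r' B ?W
        \<le> bexp r' B (\<lambda>S. of_bool (escapes \<eta> n 0 S) * ?W S)"
    proof -
      have "bexp r B (\<lambda>S. of_bool (\<exists>y\<in>{y. n < level \<eta> y}. half.reach ({} \<union> S) 0 y)) * bexp r' B (\<lambda>S. ?W ({} \<union> S))
          \<le> bexp r' B (\<lambda>S. of_bool (\<exists>y\<in>{y. n < level \<eta> y}. half.reach ({} \<union> S) 0 y) * ?W ({} \<union> S))"
        by (rule half.tilted_exploration[OF pos B r(1,4,5,3) c(3,2) r_le])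
           (rule safe[OF finite_subset[OF _ B]], assumption, simp)
      then show ?thesis
        by (simp add: escapes_def conj_commute)
    qed
    also have "\<dots> \<le> bexp r' B (\<lambda>S. exp (- \<kappa> * real n))"
    proof (rule bexp_mono)
      fix S
      show "of_bool (escapes \<eta> n 0 S) * ?W S \<le> exp (- \<kappa> * real n)"
      proof (cases "escapes \<eta> n 0 S")
        case True
        then obtain y where y: "half.reach S 0 y" "n < level \<eta> y"
          by (auto simp: escapes_def)
        have "?W S \<le> \<phi> y" using pos y by (intro half.weight_le)
        also have "\<dots> \<le> exp (- \<kappa> * real n)" using y \<kappa> by (simp add: \<phi>_def)
        finally show ?thesis using True by simp
      qed simp
    qed (use r in auto)
    also have "\<dots> = exp (- \<kappa> * real n)" using B by simp
    finally have *: "bexp r B (\<lambda>S. of_bool (escapes \<eta> n 0 S)) * bexp r' B ?W \<le> exp (- \<kappa> * real n)" .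
    have "bexp r B (\<lambda>S. of_bool (escapes \<eta> n 0 S)) * (c * (1 - \<epsilon>))
        \<le> bexp r B (\<lambda>S. of_bool (escapes \<eta> n 0 S)) * bexp r' B ?W"
      using W r by (intro mult_left_mono bexp_nonneg) auto
    with * have "bexp r B (\<lambda>S. of_bool (escapes \<eta> n 0 S)) * (c * (1 - \<epsilon>)) \<le> exp (- \<kappa> * real n)"
      by linarith
    moreover have "0 < c * (1 - \<epsilon>)" using \<epsilon> by (simp add: c_def)
    ultimately show ?thesis by (simp add: pos_le_divide_eq)
  qed
  have "escape_prob TYPE('d) p \<eta> n \<le> 1 / (c * (1 - \<epsilon>)) * exp (- \<kappa> * real n)" for n
    using assms bound by (intro escape_prob_leI) (auto simp: r_def)
  moreover have "0 < 1 / (c * (1 - \<epsilon>))" using \<epsilon> by (simp add: c_def)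
  ultimately show ?thesis using \<kappa> by blast
qed

section \<open>A positive chance of never leaving the cone\<close>

lemma finite_simplex: "finite {v :: int ^ 'd::finite. (\<forall>i. 0 \<le> v $ i) \<and> (\<Sum>i\<in>UNIV. v $ i) \<le> K}"
proof (rule finite_subset)
  show "{v :: int ^ 'd. (\<forall>i. 0 \<le> v $ i) \<and> (\<Sum>i\<in>UNIV. v $ i) \<le> K} \<subseteq> vec_lambda ` (UNIV \<rightarrow>\<^sub>E {0..K})"
  proof
    fix v :: "int ^ 'd"
    assume "v \<in> {v. (\<forall>i. 0 \<le> v $ i) \<and> (\<Sum>i\<in>UNIV. v $ i) \<le> K}"
    then have v: "0 \<le> v $ i" "(\<Sum>i\<in>UNIV. v $ i) \<le> K" for i by auto
    have "v $ i \<le> K" for i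
      using member_le_sum[of i UNIV "($) v"] v by (simp add: order_trans)
    then show "v \<in> vec_lambda ` (UNIV \<rightarrow>\<^sub>E {0..K})"
      using v by (intro image_eqI[of _ _ "($) v"]) auto
  qed
  show "finite (vec_lambda ` (UNIV \<rightarrow>\<^sub>E {0..K}) :: (int ^ 'd) set)"
    by (intro finite_imageI finite_PiE) auto
qed

lemma sum_add_axis: "(\<Sum>j\<in>UNIV. (v + axis i 1 :: int ^ 'd::finite) $ j) = (\<Sum>j\<in>UNIV. v $ j) + 1"
  by (simp add: sum.distrib axis_def)

text \<open>
  When the simplex \<open>D\<close> at the origin is closed, the cluster leaves it only through the layer \<open>L\<close>
  above it, whose sites lie so deep in the cone that a loss of \<open>N\<close> levels from there is harmless.
\<close>

lemma escape_prob_0_less_1: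
  assumes "0 < p" "p \<le> 1" and N: "escape_prob TYPE('d::finite) p \<eta> N < 1"
  shows "escape_prob TYPE('d) p \<eta> 0 < 1"
proof -
  obtain M :: nat where M: "2 * real CARD('d) * real N / (1 - \<eta>) \<le> real M"
    using real_arch_simple by blast
  define D L :: "(int ^ 'd) set" where
    "D = {v. (\<forall>i. 0 \<le> v $ i) \<and> (\<Sum>i\<in>UNIV. v $ i) \<le> int M}" and
    "L = {v. (\<forall>i. 0 \<le> v $ i) \<and> (\<Sum>i\<in>UNIV. v $ i) = int M + 1}"
  have "L \<subseteq> {v. (\<forall>i. 0 \<le> v $ i) \<and> (\<Sum>i\<in>UNIV. v $ i) \<le> int M + 1}"
    by (auto simp: L_def)
  then have fin: "finite D" "finite L"
    unfolding D_def using finite_simplex finite_subset by blast+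
  define \<delta> where "\<delta> = p ^ card D * (1 - escape_prob TYPE('d) p \<eta> N) ^ card L"
  \<comment> \<open>The bound is the product over finitely many decreasing events of positive probability.\<close>
  have \<delta>: "0 < \<delta>" using assms by (simp add: \<delta>_def)
  have inside: "\<not> escapes \<eta> 0 0 S"
    if closed: "\<And>v. v \<in> D \<Longrightarrow> v \<notin> S" and good: "\<And>u. u \<in> L \<Longrightarrow> \<not> escapes \<eta> N u S" for S
  proof -
    have "level \<eta> y = 0" if "half.reach S 0 y" for y
    proof -
      from that have "y \<in> D \<or> (\<exists>u\<in>L. half.reach S u y)"
      proof (induction rule: half.reach_induct)
        case refl
        show ?case by (simp add: D_def)
      next
        case (base y z)
        then obtain i where z: "z = y + axis i 1" by auto
        from base.IH show ?case
        proof
          assume "y \<in> D"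
          then have "z \<in> D \<or> z \<in> L"
            using sum_add_axis[of y i] unfolding z D_def L_def
            by (auto simp: axis_def)
          then show ?thesis using half.reach_refl by blast
        qed (use base half.reach_base in blast)
      next
        case (bonus y z)
        then show ?case using closed half.reach_bonus by blast
      qed
      then show ?thesis
      proof
        assume "y \<in> D"
        then show ?thesis by (intro level_eq_0[OF eta]) (auto simp: D_def)
      next
        assume "\<exists>u\<in>L. half.reach S u y"
        then obtain u where u: "u \<in> L" "half.reach S u y" by auto
        then have y: "level \<eta> (y - u) \<le> N"
          using good by (auto simp: escapes_def not_less)
        have "2 * real CARD('d) * real N \<le> real M * (1 - \<eta>)"
          using M eta by (simp add: pos_divide_le_eq)
        also have "\<dots> \<le> (real M + 1) * (1 - \<eta>)"
          using eta by (intro mult_right_mono) auto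
        also have "real M + 1 = real_of_int (\<Sum>i\<in>UNIV. u $ i)"
          using u by (simp add: L_def)
        finally have deep: "2 * real CARD('d) * real N \<le> real_of_int (\<Sum>i\<in>UNIV. u $ i) * (1 - \<eta>)" .
        have "0 \<le> u $ i" for i using u by (simp add: L_def)
        then have "level \<eta> (u + (y - u)) = 0"
          by (rule level_eq_0_deep[OF eta _ deep y])
        then show ?thesis by simp
      qed
    qed
    then show ?thesis by (auto simp: escapes_def)
  qed
  have "escape_prob TYPE('d) p \<eta> 0 \<le> 1 - \<delta>"
  proof (rule escape_prob_leI)
    fix B :: "(int ^ 'd) set" assume B: "finite B"
    let ?r = "1 - p"
    have r: "0 \<le> ?r" "?r \<le> 1" "0 \<le> p" using assms by auto
    have "p \<le> bexp ?r B (\<lambda>S. of_bool (v \<notin> S))" for v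
      using bexp_closed_ge[OF B r(1,2), of v] by simp
    then have f: "p ^ card D \<le> bexp ?r B (\<lambda>S. of_bool (\<forall>v\<in>D. v \<notin> S))"
      using B r fin by (intro bexp_Ball_ge_Harris) blast+
    have "1 - escape_prob TYPE('d) p \<eta> N \<le> bexp ?r B (\<lambda>S. of_bool (\<not> escapes \<eta> N u S))" for u
      using bexp_escapes_le_escape_prob[OF r(3) assms(2) B, of \<eta> N u] by (simp add: bexp_not[OF B])
    then have g: "(1 - escape_prob TYPE('d) p \<eta> N) ^ card L \<le> bexp ?r B (\<lambda>S. of_bool (\<forall>u\<in>L. \<not> escapes \<eta> N u S))"
      using N by (intro bexp_Ball_ge_Harris[OF B r(1,2) fin(2)]) (simp, blast dest: escapes_mono)
    have "\<delta> \<le> bexp ?r B (\<lambda>S. of_bool (\<forall>v\<in>D. v \<notin> S)) * bexp ?r B (\<lambda>S. of_bool (\<forall>u\<in>L. \<not> escapes \<eta> N u S))"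
      unfolding \<delta>_def using N r by (intro mult_mono[OF f g] bexp_nonneg) simp_all
    also have "\<dots> \<le> bexp ?r B (\<lambda>S. of_bool ((\<forall>v\<in>D. v \<notin> S) \<and> (\<forall>u\<in>L. \<not> escapes \<eta> N u S)))"
      by (rule bexp_conj_ge_Harris[OF B r(1,2)]) (blast dest: escapes_mono)+
    also have "\<dots> \<le> bexp ?r B (\<lambda>S. of_bool (\<not> escapes \<eta> 0 0 S))"
      using inside by (intro bexp_mono[OF r(1,2)]) (simp add: of_bool_def)
    also have "\<dots> = 1 - bexp ?r B (\<lambda>S. of_bool (escapes \<eta> 0 0 S))"
      by (rule bexp_not[OF B])
    finally show "bexp ?r B (\<lambda>S. of_bool (escapes \<eta> 0 0 S)) \<le> 1 - \<delta>" by simp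
  qed (use assms in auto)
  then show ?thesis using \<delta> by simp
qed

section \<open>The critical value and the conclusion\<close>

text \<open>
  With all sites closed the cluster is the positive orthant. This shows that the set whose infimum
  defines the critical value is nonempty, so that the infimum is meaningful.
\<close>

lemma escape_prob_1: "escape_prob TYPE('d::finite) 1 \<eta> n \<le> 0"
proof (rule escape_prob_leI)
  fix B :: "(int ^ 'd) set" assume "finite B"
  then have "bexp (1 - 1) B f = f {}" for f :: "(int ^ 'd) set \<Rightarrow> real"
    by (induction B rule: finite_induct) (auto simp: bexp_insert)
  moreover have "level \<eta> y = 0" if "half.reach {} 0 y" for y :: "int ^ 'd"
  proof -
    from that have "\<forall>i. 0 \<le> y $ i"
      by (induction rule: half.reach_induct) (auto simp: axis_def)
    then show ?thesis by (intro level_eq_0[OF eta]) auto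
  qed
  ultimately show "bexp (1 - 1) B (\<lambda>S. of_bool (escapes \<eta> n 0 S)) \<le> 0"
    by (auto simp: escapes_def)
qed auto

lemma crit_value_lessD:
  assumes "crit_value TYPE('d::finite) \<eta> < p"
  obtains q where "0 \<le> q" "q \<le> 1" "q < p" "escape_prob TYPE('d) q \<eta> \<longlonglongrightarrow> 0"
proof -
  let ?X = "{q \<in> {0..1}. measure (orthant_law q) {\<omega> :: int ^ 'd \<Rightarrow> bool. \<exists>n. \<not> escapes \<eta> n 0 (open_sites \<omega>)} = 1}"
  have crit: "crit_value TYPE('d) \<eta> = Inf ?X"
    by (simp add: crit_value_def cluster_in_shifted_cone_iff)
  have "1 \<in> ?X"
  proof -
    interpret prob_space "orthant_law 1 :: (int ^ 'd \<Rightarrow> bool) measure" by (rule prob_space_orthant_law)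
    let ?E = "\<lambda>n. {\<omega> :: int ^ 'd \<Rightarrow> bool. escapes \<eta> n 0 (open_sites \<omega>)}"
    have sets: "?E n \<in> events" for n
      by (intro escapes_event(1)) auto
    have "1 = prob (space (orthant_law 1) - ?E 0)"
      using prob_compl[OF sets, of 0] escape_prob_1[where 'd = 'd, of 0]
      by (simp add: escape_prob_def measure_le_0_iff)
    also have "\<dots> \<le> prob {\<omega> :: int ^ 'd \<Rightarrow> bool. \<exists>n. \<not> escapes \<eta> n 0 (open_sites \<omega>)}"
      by (intro finite_measure_mono bounded_cluster_measurable) auto
    finally show ?thesis using prob_le_1 by (auto intro: antisym)
  qed
  then have "?X \<noteq> {}" by blast
  from cInf_lessD[OF this assms[unfolded crit]] obtain q where "q \<in> ?X" "q < p" ..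
  then show ?thesis
    using escape_prob_tendsto_0[where 'd = 'd, of q] by (intro that[of q]) auto
qed

end

text \<open>
  Half of the rate beats the constant \<open>C\<close> beyond some \<open>m\<close>; below it the uniform bound \<open>1 - \<delta>\<close> suffices
  for a small enough rate.
\<close>

lemma exp_decay_absorb_constant:
  fixes f :: "nat \<Rightarrow> real"
  assumes "0 < \<kappa>" "0 < \<delta>" and f: "\<And>n. f n \<le> C * exp (- \<kappa> * real n)" "\<And>n. f n \<le> 1 - \<delta>"
  shows "\<exists>c>0. \<forall>n. f n \<le> exp (- c * real n)"
proof -
  obtain m :: nat where m: "2 * C / \<kappa> \<le> real m"
    using real_arch_simple by blast
  define c where "c = min (\<kappa> / 2) (\<delta> / (real m + 1))"
  have c: "0 < c" "c \<le> \<kappa> / 2" "c \<le> \<delta> / (real m + 1)"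
    unfolding c_def using assms(1,2) by (simp, intro min.cobounded1, intro min.cobounded2)
  from c(3) have c': "c * (real m + 1) \<le> \<delta>"
    by (subst (asm) pos_le_divide_eq) auto
  have "f n \<le> exp (- c * real n)" for n
  proof (cases "n \<le> m")
    case True
    have "c * real n \<le> c * (real m + 1)"
      using True c by (intro mult_left_mono) auto
    then have "1 - \<delta> \<le> 1 + (- c * real n)" using c' by simp
    also have "\<dots> \<le> exp (- c * real n)" by (rule exp_ge_add_one_self)
    finally show ?thesis using f(2) by (meson order_trans)
  next
    case False
    have "C \<le> \<kappa> / 2 * real m"
      using m assms by (simp add: field_simps)
    also have "\<dots> \<le> \<kappa> / 2 * real n"
      using False assms by (intro mult_left_mono) auto
    also have "\<dots> \<le> exp (\<kappa> / 2 * real n)"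
      using exp_ge_add_one_self[of "\<kappa> / 2 * real n"] by linarith
    finally have "C * exp (- \<kappa> * real n) \<le> exp (\<kappa> / 2 * real n) * exp (- \<kappa> * real n)"
      by (intro mult_right_mono) auto
    also have "\<dots> = exp (- (\<kappa> / 2) * real n)"
      by (simp add: field_simps flip: exp_add)
    also have "\<dots> \<le> exp (- c * real n)"
      using mult_right_mono[OF c(2), of "real n"] by simp
    finally show ?thesis using f(1) by (meson order_trans)
  qed
  then show ?thesis using c by blast
qed

theorem theorem1:
  fixes p \<eta> :: real
  assumes "CARD('d::finite) \<ge> 2"
    and "0 \<le> p" and "p \<le> 1"
    and "0 \<le> \<eta>" and "\<eta> < 1"
    and "p > crit_value TYPE('d) \<eta>"
  shows "\<exists>c>0. \<forall>n::nat.
    \<P>(\<omega> in (orthant_law p :: (int ^ 'd \<Rightarrow> bool) measure).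
       connects_set \<omega> 0 (- shifted_cone n \<eta>)) \<le> exp (- c * real n)"
proof -
  have eta: "0 \<le> \<eta>" "\<eta> < 1" by fact+
  let ?\<theta> = "escape_prob TYPE('d) p \<eta>"
  obtain q where q: "0 \<le> q" "q < p" "escape_prob TYPE('d) q \<eta> \<longlonglongrightarrow> 0"
    using crit_value_lessD[OF eta assms(6)] by blast
  obtain C \<kappa> where C: "0 < C" "0 < \<kappa>" "\<And>n. ?\<theta> n \<le> C * exp (- \<kappa> * real n)"
    using escape_prob_exp_decay[OF eta q(1,2) assms(3) q(3)] by blast
  obtain N :: nat where N: "C / \<kappa> \<le> real N"
    using real_arch_simple by blast
  have "C \<le> \<kappa> * real N"
    using N C(2) by (simp add: field_simps)
  then have "C < exp (\<kappa> * real N)"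
    using exp_ge_add_one_self[of "\<kappa> * real N"] by linarith
  then have "C * exp (- \<kappa> * real N) < 1"
    by (simp add: exp_minus field_simps)
  then have "?\<theta> N < 1"
    using C(3)[of N] by linarith
  then have "?\<theta> 0 < 1"
    using escape_prob_0_less_1[where 'd = 'd, OF eta] q assms by simp
  moreover have "?\<theta> n \<le> ?\<theta> 0" for n
  proof -
    interpret prob_space "orthant_law p :: (int ^ 'd \<Rightarrow> bool) measure" by (rule prob_space_orthant_law)
    show ?thesis
      unfolding escape_prob_def
      by (intro finite_measure_mono escapes_event(1) assms Collect_mono impI) (auto elim: escapes_antimono)
  qed
  ultimately have "\<exists>c>0. \<forall>n. ?\<theta> n \<le> exp (- c * real n)"
    using C by (intro exp_decay_absorb_constant[of \<kappa> "1 - ?\<theta> 0"]) auto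
  then show ?thesis
    by (simp add: escape_prob_def connects_set_iff_escapes[OF eta])
qed

end
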